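(* Not every $2$-terminal object in the strict-slice of lax-cones over a $2$-functor is a lax-limit: there exist $2$-categories $I$ and $\mathcal{A}$, a $2$-functor $F\colon I\to\mathcal{A}$, and an object $(L,\lambda\colon\Delta L\Rightarrow F)$ which is $2$-terminal in the strict-slice of lax-cones over $F$ but is not a lax-limit of $F$.
   Context: $2$-categories and $2$-functors are strict; $*$ denotes horizontal composition (and whiskering) of $2$-morphisms and juxtaposition denotes vertical composition. A lax-natural transformation $\mu\colon F\Rightarrow G$ between $2$-functors $F,G\colon I\to\mathcal{A}$ consists of morphisms $\mu_i\colon Fi\to Gi$ for $i\in I$ and $2$-morphisms $\mu_f\colon(Gf)\mu_i\Rightarrow\mu_j(Ff)$ for $f\colon i\to j$ in $I$, such that $\mu_{\mathrm{id}_i}=\mathrm{id}_{\mu_i}$, $\mu_{gf}=(\mu_g*Ff)(Gg*\mu_f)$ for composable $f,g$, and $\mu_g(G\alpha*\mu_i)=(\mu_j*F\alpha)\mu_f$ for every $2$-morphism $\alpha\colon f\Rightarrow g$ in $I$. A modification $\varphi\colon\mu\to\nu$ consists of $2$-morphisms $\varphi_i\colon\mu_i\Rightarrow\nu_i$ with $\nu_f(Gf*\varphi_i)=(\varphi_j*Ff)\mu_f$ for every $f\colon i\to j$. $\mathrm{Lax}[I,\mathcal{A}]$ is the $2$-category of $2$-functors, lax-natural transformations and modifications. $\Delta X$ is the constant $2$-functor at $X$; a lax-cone over $F$ is a lax-natural transformation $\Delta X\Rightarrow F$. A lax-limit of $F$ is a pair $(L,\lambda\colon\Delta L\Rightarrow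 F)$ with $\lambda$ a lax-cone such that for each $X\in\mathcal{A}$ the functor $\lambda_*\circ\Delta\colon\mathcal{A}(X,L)\to\mathrm{Lax}[I,\mathcal{A}](\Delta X,F)$, given by post-composition with $\lambda$, is an isomorphism of categories. The strict-slice of lax-cones over $F$ is the $2$-category whose objects are pairs $(X,\mu)$ with $\mu\colon\Delta X\Rightarrow F$ a lax-cone; morphisms $(X,\mu)\to(Y,\nu)$ are morphisms $f\colon X\to Y$ of $\mathcal{A}$ with $\nu\Delta f=\mu$; $2$-morphisms $f\Rightarrow g$ are $2$-morphisms $\alpha\colon f\Rightarrow g$ of $\mathcal{A}$ with $\nu*\Delta\alpha=\mathrm{id}_\mu$. An object $L$ of a $2$-category $\mathcal{B}$ is $2$-terminal if for all $X\in\mathcal{B}$ the category $\mathcal{B}(X,L)$ is isomorphic to the terminal category $\mathbb{1}$. *)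

theory Defs
  imports "HOL-Library.FuncSet"
begin

section \<open>Categories, functors, isomorphism of categories\<close>

record ('o, 'a) cat =
  CObj :: "'o set"
  CArr :: "'a set"
  CDom :: "'a \<Rightarrow> 'o"
  CCod :: "'a \<Rightarrow> 'o"
  CIde :: "'o \<Rightarrow> 'a"
  CCmp :: "'a \<Rightarrow> 'a \<Rightarrow> 'a"  \<comment> \<open>\<open>CCmp C g f\<close> is \<open>g\<close> after \<open>f\<close>\<close>

locale category =
  fixes C :: "('o, 'a) cat"
  assumes dom_in: "f \<in> CArr C \<Longrightarrow> CDom C f \<in> CObj C"
    and cod_in: "f \<in> CArr C \<Longrightarrow> CCod C f \<in> CObj C"
    and ide_in: "x \<in> CObj C \<Longrightarrow> CIde C x \<in> CArr C"
    and dom_ide: "x \<in> CObj C \<Longrightarrow> CDom C (CIde C x) = x"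
    and cod_ide: "x \<in> CObj C \<Longrightarrow> CCod C (CIde C x) = x"
    and cmp_in: "\<lbrakk>f \<in> CArr C; g \<in> CArr C; CDom C g = CCod C f\<rbrakk> \<Longrightarrow> CCmp C g f \<in> CArr C"
    and dom_cmp: "\<lbrakk>f \<in> CArr C; g \<in> CArr C; CDom C g = CCod C f\<rbrakk> \<Longrightarrow> CDom C (CCmp C g f) = CDom C f"
    and cod_cmp: "\<lbrakk>f \<in> CArr C; g \<in> CArr C; CDom C g = CCod C f\<rbrakk> \<Longrightarrow> CCod C (CCmp C g f) = CCod C g"
    and cmp_ide: "f \<in> CArr C \<Longrightarrow> CCmp C f (CIde C (CDom C f)) = f"
    and ide_cmp: "f \<in> CArr C \<Longrightarrow> CCmp C (CIde C (CCod C f)) f = f"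
    and cmp_assoc: "\<lbrakk>f \<in> CArr C; g \<in> CArr C; h \<in> CArr C; CDom C g = CCod C f; CDom C h = CCod C g\<rbrakk>
        \<Longrightarrow> CCmp C h (CCmp C g f) = CCmp C (CCmp C h g) f"

record ('o, 'a, 'p, 'b) cfunctor =
  FObj :: "'o \<Rightarrow> 'p"
  FArr :: "'a \<Rightarrow> 'b"

locale cat_functor =
  fixes C :: "('o, 'a) cat" and D :: "('p, 'b) cat" and F :: "('o, 'a, 'p, 'b) cfunctor"
  assumes obj: "x \<in> CObj C \<Longrightarrow> FObj F x \<in> CObj D"
    and arr: "f \<in> CArr C \<Longrightarrow> FArr F f \<in> CArr D"
    and dom: "f \<in> CArr C \<Longrightarrow> CDom D (FArr F f) = FObj F (CDom C f)"
    and cod: "f \<in> CArr C \<Longrightarrow> CCod D (FArr F f) = FObj F (CCod C f)"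
    and ide: "x \<in> CObj C \<Longrightarrow> FArr F (CIde C x) = CIde D (FObj F x)"
    and cmp: "\<lbrakk>f \<in> CArr C; g \<in> CArr C; CDom C g = CCod C f\<rbrakk>
        \<Longrightarrow> FArr F (CCmp C g f) = CCmp D (FArr F g) (FArr F f)"

definition cfunctor_cmp ::
    "('p, 'b, 'q, 'c) cfunctor \<Rightarrow> ('o, 'a, 'p, 'b) cfunctor \<Rightarrow> ('o, 'a, 'q, 'c) cfunctor" where
  "cfunctor_cmp G F = \<lparr>FObj = FObj G \<circ> FObj F, FArr = FArr G \<circ> FArr F\<rparr>"

definition iso_functor ::
    "('o, 'a) cat \<Rightarrow> ('p, 'b) cat \<Rightarrow> ('o, 'a, 'p, 'b) cfunctor \<Rightarrow> bool" where
  "iso_functor C D F \<longleftrightarrow> cat_functor C D F \<and>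
     (\<exists>G. cat_functor D C G \<and>
        (\<forall>x\<in>CObj C. FObj G (FObj F x) = x) \<and> (\<forall>f\<in>CArr C. FArr G (FArr F f) = f) \<and>
        (\<forall>y\<in>CObj D. FObj F (FObj G y) = y) \<and> (\<forall>g\<in>CArr D. FArr F (FArr G g) = g))"

definition isomorphic_cats :: "('o, 'a) cat \<Rightarrow> ('p, 'b) cat \<Rightarrow> bool" where
  "isomorphic_cats C D \<longleftrightarrow> (\<exists>F. iso_functor C D F)"

definition terminal_cat :: "(unit, unit) cat" where
  "terminal_cat = \<lparr>CObj = UNIV, CArr = UNIV, CDom = (\<lambda>_. ()), CCod = (\<lambda>_. ()),
     CIde = (\<lambda>_. ()), CCmp = (\<lambda>_ _. ())\<rparr>"


section \<open>Strict 2-categories and 2-functors\<close>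

record ('o, 'm, 'c) two_cat =
  Obj :: "'o set"
  Mor :: "'m set"
  Cell :: "'c set"
  Dom :: "'m \<Rightarrow> 'o"
  Cod :: "'m \<Rightarrow> 'o"
  Ide :: "'o \<Rightarrow> 'm"
  Cmp :: "'m \<Rightarrow> 'm \<Rightarrow> 'm"  \<comment> \<open>\<open>Cmp A g f\<close> is \<open>g\<close> after \<open>f\<close>; likewise \<open>VCmp\<close> and \<open>HCmp\<close>\<close>
  Src :: "'c \<Rightarrow> 'm"
  Tgt :: "'c \<Rightarrow> 'm"
  VIde :: "'m \<Rightarrow> 'c"
  VCmp :: "'c \<Rightarrow> 'c \<Rightarrow> 'c"
  HCmp :: "'c \<Rightarrow> 'c \<Rightarrow> 'c"

definition underlying_cat :: "('o, 'm, 'c) two_cat \<Rightarrow> ('o, 'm) cat" where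
  "underlying_cat A = \<lparr>CObj = Obj A, CArr = Mor A, CDom = Dom A, CCod = Cod A,
     CIde = Ide A, CCmp = Cmp A\<rparr>"

definition vertical_cat :: "('o, 'm, 'c) two_cat \<Rightarrow> ('m, 'c) cat" where
  "vertical_cat A = \<lparr>CObj = Mor A, CArr = Cell A, CDom = Src A, CCod = Tgt A,
     CIde = VIde A, CCmp = VCmp A\<rparr>"

definition horizontal_cat :: "('o, 'm, 'c) two_cat \<Rightarrow> ('o, 'c) cat" where
  "horizontal_cat A = \<lparr>CObj = Obj A, CArr = Cell A,
     CDom = (\<lambda>\<alpha>. Dom A (Src A \<alpha>)), CCod = (\<lambda>\<alpha>. Cod A (Src A \<alpha>)),
     CIde = (\<lambda>X. VIde A (Ide A X)), CCmp = HCmp A\<rparr>"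

locale two_category =
  fixes A :: "('o, 'm, 'c) two_cat"
  assumes underlying: "category (underlying_cat A)"
    and vertical: "category (vertical_cat A)"
    and horizontal: "category (horizontal_cat A)"
    and dom_tgt: "\<alpha> \<in> Cell A \<Longrightarrow> Dom A (Tgt A \<alpha>) = Dom A (Src A \<alpha>)"
    and cod_tgt: "\<alpha> \<in> Cell A \<Longrightarrow> Cod A (Tgt A \<alpha>) = Cod A (Src A \<alpha>)"
    and src_hcmp: "\<lbrakk>\<alpha> \<in> Cell A; \<beta> \<in> Cell A; Dom A (Src A \<beta>) = Cod A (Src A \<alpha>)\<rbrakk>
        \<Longrightarrow> Src A (HCmp A \<beta> \<alpha>) = Cmp A (Src A \<beta>) (Src A \<alpha>)"
    and tgt_hcmp: "\<lbrakk>\<alpha> \<in> Cell A; \<beta> \<in> Cell A; Dom A (Src A \<beta>) = Cod A (Src A \<alpha>)\<rbrakk>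
        \<Longrightarrow> Tgt A (HCmp A \<beta> \<alpha>) = Cmp A (Tgt A \<beta>) (Tgt A \<alpha>)"
    and hcmp_vide: "\<lbrakk>f \<in> Mor A; g \<in> Mor A; Dom A g = Cod A f\<rbrakk>
        \<Longrightarrow> HCmp A (VIde A g) (VIde A f) = VIde A (Cmp A g f)"
    and interchange: "\<lbrakk>\<alpha> \<in> Cell A; \<alpha>' \<in> Cell A; \<beta> \<in> Cell A; \<beta>' \<in> Cell A;
          Src A \<alpha>' = Tgt A \<alpha>; Src A \<beta>' = Tgt A \<beta>; Dom A (Src A \<beta>) = Cod A (Src A \<alpha>)\<rbrakk>
        \<Longrightarrow> HCmp A (VCmp A \<beta>' \<beta>) (VCmp A \<alpha>' \<alpha>) = VCmp A (HCmp A \<beta>' \<alpha>') (HCmp A \<beta> \<alpha>)"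

abbreviation whisker_left :: "('o, 'm, 'c) two_cat \<Rightarrow> 'm \<Rightarrow> 'c \<Rightarrow> 'c" where
  "whisker_left A g \<alpha> \<equiv> HCmp A (VIde A g) \<alpha>"

abbreviation whisker_right :: "('o, 'm, 'c) two_cat \<Rightarrow> 'c \<Rightarrow> 'm \<Rightarrow> 'c" where
  "whisker_right A \<alpha> f \<equiv> HCmp A \<alpha> (VIde A f)"

definition hom_cat :: "('o, 'm, 'c) two_cat \<Rightarrow> 'o \<Rightarrow> 'o \<Rightarrow> ('m, 'c) cat" where
  "hom_cat A X Y =
    \<lparr>CObj = {f \<in> Mor A. Dom A f = X \<and> Cod A f = Y},
     CArr = {\<alpha> \<in> Cell A. Dom A (Src A \<alpha>) = X \<and> Cod A (Src A \<alpha>) = Y},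
     CDom = Src A, CCod = Tgt A, CIde = VIde A, CCmp = VCmp A\<rparr>"

definition two_terminal :: "('o, 'm, 'c) two_cat \<Rightarrow> 'o \<Rightarrow> bool" where
  "two_terminal B L \<longleftrightarrow> L \<in> Obj B \<and> (\<forall>X\<in>Obj B. isomorphic_cats (hom_cat B X L) terminal_cat)"

record ('i, 'j, 'k, 'o, 'm, 'c) two_fun =
  TObj :: "'i \<Rightarrow> 'o"
  TMor :: "'j \<Rightarrow> 'm"
  TCell :: "'k \<Rightarrow> 'c"

text \<open>2-functors, lax-natural transformations and modifications are themselves objects,
  morphisms and 2-morphisms of a 2-category. Their components are therefore extensional
  functions, so that equality in HOL is equality on the objects and morphisms of the
  domain.\<close>

locale two_functor =
  fixes I :: "('i, 'j, 'k) two_cat" and A :: "('o, 'm, 'c) two_cat"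
    and F :: "('i, 'j, 'k, 'o, 'm, 'c) two_fun"
  assumes obj: "TObj F \<in> Obj I \<rightarrow>\<^sub>E Obj A"
    and mor: "TMor F \<in> Mor I \<rightarrow>\<^sub>E Mor A"
    and cell: "TCell F \<in> Cell I \<rightarrow>\<^sub>E Cell A"
    and dom: "f \<in> Mor I \<Longrightarrow> Dom A (TMor F f) = TObj F (Dom I f)"
    and cod: "f \<in> Mor I \<Longrightarrow> Cod A (TMor F f) = TObj F (Cod I f)"
    and ide: "i \<in> Obj I \<Longrightarrow> TMor F (Ide I i) = Ide A (TObj F i)"
    and cmp: "\<lbrakk>f \<in> Mor I; g \<in> Mor I; Dom I g = Cod I f\<rbrakk>
        \<Longrightarrow> TMor F (Cmp I g f) = Cmp A (TMor F g) (TMor F f)"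
    and src: "\<alpha> \<in> Cell I \<Longrightarrow> Src A (TCell F \<alpha>) = TMor F (Src I \<alpha>)"
    and tgt: "\<alpha> \<in> Cell I \<Longrightarrow> Tgt A (TCell F \<alpha>) = TMor F (Tgt I \<alpha>)"
    and vide: "f \<in> Mor I \<Longrightarrow> TCell F (VIde I f) = VIde A (TMor F f)"
    and vcmp: "\<lbrakk>\<alpha> \<in> Cell I; \<beta> \<in> Cell I; Src I \<beta> = Tgt I \<alpha>\<rbrakk>
        \<Longrightarrow> TCell F (VCmp I \<beta> \<alpha>) = VCmp A (TCell F \<beta>) (TCell F \<alpha>)"
    and hcmp: "\<lbrakk>\<alpha> \<in> Cell I; \<beta> \<in> Cell I; Dom I (Src I \<beta>) = Cod I (Src I \<alpha>)\<rbrakk>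
        \<Longrightarrow> TCell F (HCmp I \<beta> \<alpha>) = HCmp A (TCell F \<beta>) (TCell F \<alpha>)"


section \<open>Lax-natural transformations and modifications\<close>

record ('i, 'j, 'k, 'o, 'm, 'c) lax_trans =
  LSrc :: "('i, 'j, 'k, 'o, 'm, 'c) two_fun"
  LTgt :: "('i, 'j, 'k, 'o, 'm, 'c) two_fun"
  LObj :: "'i \<Rightarrow> 'm"
  LMor :: "'j \<Rightarrow> 'c"

locale lax_natural =
  fixes I :: "('i, 'j, 'k) two_cat" and A :: "('o, 'm, 'c) two_cat"
    and \<mu> :: "('i, 'j, 'k, 'o, 'm, 'c) lax_trans"
  assumes source: "two_functor I A (LSrc \<mu>)"
    and target: "two_functor I A (LTgt \<mu>)"
    and obj: "LObj \<mu> \<in> Obj I \<rightarrow>\<^sub>E Mor A"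
    and dom_obj: "i \<in> Obj I \<Longrightarrow> Dom A (LObj \<mu> i) = TObj (LSrc \<mu>) i"
    and cod_obj: "i \<in> Obj I \<Longrightarrow> Cod A (LObj \<mu> i) = TObj (LTgt \<mu>) i"
    and mor: "LMor \<mu> \<in> Mor I \<rightarrow>\<^sub>E Cell A"
    and src_mor: "f \<in> Mor I
        \<Longrightarrow> Src A (LMor \<mu> f) = Cmp A (TMor (LTgt \<mu>) f) (LObj \<mu> (Dom I f))"
    and tgt_mor: "f \<in> Mor I
        \<Longrightarrow> Tgt A (LMor \<mu> f) = Cmp A (LObj \<mu> (Cod I f)) (TMor (LSrc \<mu>) f)"
    and ide: "i \<in> Obj I \<Longrightarrow> LMor \<mu> (Ide I i) = VIde A (LObj \<mu> i)"
    and cmp: "\<lbrakk>f \<in> Mor I; g \<in> Mor I; Dom I g = Cod I f\<rbrakk>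
        \<Longrightarrow> LMor \<mu> (Cmp I g f) =
            VCmp A (whisker_right A (LMor \<mu> g) (TMor (LSrc \<mu>) f))
                   (whisker_left A (TMor (LTgt \<mu>) g) (LMor \<mu> f))"
    and natural: "\<alpha> \<in> Cell I
        \<Longrightarrow> VCmp A (LMor \<mu> (Tgt I \<alpha>))
                   (whisker_right A (TCell (LTgt \<mu>) \<alpha>) (LObj \<mu> (Dom I (Src I \<alpha>)))) =
            VCmp A (whisker_left A (LObj \<mu> (Cod I (Src I \<alpha>))) (TCell (LSrc \<mu>) \<alpha>))
                   (LMor \<mu> (Src I \<alpha>))"

record ('i, 'j, 'k, 'o, 'm, 'c) modif =
  MSrc :: "('i, 'j, 'k, 'o, 'm, 'c) lax_trans"
  MTgt :: "('i, 'j, 'k, 'o, 'm, 'c) lax_trans"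
  MObj :: "'i \<Rightarrow> 'c"

locale modification =
  fixes I :: "('i, 'j, 'k) two_cat" and A :: "('o, 'm, 'c) two_cat"
    and \<phi> :: "('i, 'j, 'k, 'o, 'm, 'c) modif"
  assumes source: "lax_natural I A (MSrc \<phi>)"
    and target: "lax_natural I A (MTgt \<phi>)"
    and parallel_src: "LSrc (MTgt \<phi>) = LSrc (MSrc \<phi>)"
    and parallel_tgt: "LTgt (MTgt \<phi>) = LTgt (MSrc \<phi>)"
    and obj: "MObj \<phi> \<in> Obj I \<rightarrow>\<^sub>E Cell A"
    and src_obj: "i \<in> Obj I \<Longrightarrow> Src A (MObj \<phi> i) = LObj (MSrc \<phi>) i"
    and tgt_obj: "i \<in> Obj I \<Longrightarrow> Tgt A (MObj \<phi> i) = LObj (MTgt \<phi>) i"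
    and natural: "f \<in> Mor I
        \<Longrightarrow> VCmp A (LMor (MTgt \<phi>) f)
                   (whisker_left A (TMor (LTgt (MSrc \<phi>)) f) (MObj \<phi> (Dom I f))) =
            VCmp A (whisker_right A (MObj \<phi> (Cod I f)) (TMor (LSrc (MSrc \<phi>)) f))
                   (LMor (MSrc \<phi>) f)"

definition lax_ide :: "('i, 'j, 'k) two_cat \<Rightarrow> ('o, 'm, 'c) two_cat
    \<Rightarrow> ('i, 'j, 'k, 'o, 'm, 'c) two_fun \<Rightarrow> ('i, 'j, 'k, 'o, 'm, 'c) lax_trans" where
  "lax_ide I A F = \<lparr>LSrc = F, LTgt = F,
     LObj = (\<lambda>i\<in>Obj I. Ide A (TObj F i)),
     LMor = (\<lambda>f\<in>Mor I. VIde A (TMor F f))\<rparr>"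

text \<open>For \<open>\<mu> : F \<Rightarrow> G\<close> and \<open>\<nu> : G \<Rightarrow> H\<close>, the component of \<open>\<nu>\<mu>\<close> at \<open>f : i \<rightarrow> j\<close> is the pasting
  \<open>(Hf)\<nu>\<^sub>i\<mu>\<^sub>i \<Rightarrow> \<nu>\<^sub>j(Gf)\<mu>\<^sub>i \<Rightarrow> \<nu>\<^sub>j\<mu>\<^sub>j(Ff)\<close>.\<close>

definition lax_cmp :: "('i, 'j, 'k) two_cat \<Rightarrow> ('o, 'm, 'c) two_cat
    \<Rightarrow> ('i, 'j, 'k, 'o, 'm, 'c) lax_trans \<Rightarrow> ('i, 'j, 'k, 'o, 'm, 'c) lax_trans
    \<Rightarrow> ('i, 'j, 'k, 'o, 'm, 'c) lax_trans" where
  "lax_cmp I A \<nu> \<mu> = \<lparr>LSrc = LSrc \<mu>, LTgt = LTgt \<nu>,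
     LObj = (\<lambda>i\<in>Obj I. Cmp A (LObj \<nu> i) (LObj \<mu> i)),
     LMor = (\<lambda>f\<in>Mor I. VCmp A (whisker_left A (LObj \<nu> (Cod I f)) (LMor \<mu> f))
                              (whisker_right A (LMor \<nu> f) (LObj \<mu> (Dom I f))))\<rparr>"

definition Lax :: "('i, 'j, 'k) two_cat \<Rightarrow> ('o, 'm, 'c) two_cat
    \<Rightarrow> (('i, 'j, 'k, 'o, 'm, 'c) two_fun, ('i, 'j, 'k, 'o, 'm, 'c) lax_trans,
        ('i, 'j, 'k, 'o, 'm, 'c) modif) two_cat" where
  "Lax I A =
    \<lparr>Obj = {F. two_functor I A F},
     Mor = {\<mu>. lax_natural I A \<mu>},
     Cell = {\<phi>. modification I A \<phi>},
     Dom = LSrc, Cod = LTgt,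
     Ide = lax_ide I A,
     Cmp = lax_cmp I A,
     Src = MSrc, Tgt = MTgt,
     VIde = (\<lambda>\<mu>. \<lparr>MSrc = \<mu>, MTgt = \<mu>, MObj = (\<lambda>i\<in>Obj I. VIde A (LObj \<mu> i))\<rparr>),
     VCmp = (\<lambda>\<psi> \<phi>. \<lparr>MSrc = MSrc \<phi>, MTgt = MTgt \<psi>,
                     MObj = (\<lambda>i\<in>Obj I. VCmp A (MObj \<psi> i) (MObj \<phi> i))\<rparr>),
     HCmp = (\<lambda>\<psi> \<phi>. \<lparr>MSrc = lax_cmp I A (MSrc \<psi>) (MSrc \<phi>),
                     MTgt = lax_cmp I A (MTgt \<psi>) (MTgt \<phi>),
                     MObj = (\<lambda>i\<in>Obj I. HCmp A (MObj \<psi> i) (MObj \<phi> i))\<rparr>)\<rparr>"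


section \<open>Lax-cones, lax-limits and the strict-slice\<close>

definition const_fun :: "('i, 'j, 'k) two_cat \<Rightarrow> ('o, 'm, 'c) two_cat \<Rightarrow> 'o
    \<Rightarrow> ('i, 'j, 'k, 'o, 'm, 'c) two_fun" where
  "const_fun I A X = \<lparr>TObj = (\<lambda>i\<in>Obj I. X), TMor = (\<lambda>f\<in>Mor I. Ide A X),
     TCell = (\<lambda>\<alpha>\<in>Cell I. VIde A (Ide A X))\<rparr>"

definition const_trans :: "('i, 'j, 'k) two_cat \<Rightarrow> ('o, 'm, 'c) two_cat \<Rightarrow> 'm
    \<Rightarrow> ('i, 'j, 'k, 'o, 'm, 'c) lax_trans" where
  "const_trans I A f = \<lparr>LSrc = const_fun I A (Dom A f), LTgt = const_fun I A (Cod A f),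
     LObj = (\<lambda>i\<in>Obj I. f), LMor = (\<lambda>k\<in>Mor I. VIde A f)\<rparr>"

definition const_modif :: "('i, 'j, 'k) two_cat \<Rightarrow> ('o, 'm, 'c) two_cat \<Rightarrow> 'c
    \<Rightarrow> ('i, 'j, 'k, 'o, 'm, 'c) modif" where
  "const_modif I A \<alpha> = \<lparr>MSrc = const_trans I A (Src A \<alpha>), MTgt = const_trans I A (Tgt A \<alpha>),
     MObj = (\<lambda>i\<in>Obj I. \<alpha>)\<rparr>"

definition Delta :: "('i, 'j, 'k) two_cat \<Rightarrow> ('o, 'm, 'c) two_cat
    \<Rightarrow> ('o, 'm, 'c, ('i, 'j, 'k, 'o, 'm, 'c) two_fun, ('i, 'j, 'k, 'o, 'm, 'c) lax_trans,
        ('i, 'j, 'k, 'o, 'm, 'c) modif) two_fun" where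
  "Delta I A = \<lparr>TObj = (\<lambda>X\<in>Obj A. const_fun I A X), TMor = (\<lambda>f\<in>Mor A. const_trans I A f),
     TCell = (\<lambda>\<alpha>\<in>Cell A. const_modif I A \<alpha>)\<rparr>"

definition lax_cone :: "('i, 'j, 'k) two_cat \<Rightarrow> ('o, 'm, 'c) two_cat
    \<Rightarrow> ('i, 'j, 'k, 'o, 'm, 'c) two_fun \<Rightarrow> 'o \<Rightarrow> ('i, 'j, 'k, 'o, 'm, 'c) lax_trans \<Rightarrow> bool" where
  "lax_cone I A F X \<mu> \<longleftrightarrow> X \<in> Obj A \<and> \<mu> \<in> Mor (Lax I A)
     \<and> Dom (Lax I A) \<mu> = TObj (Delta I A) X \<and> Cod (Lax I A) \<mu> = F"

definition local_functor :: "('i, 'j, 'k, 'o, 'm, 'c) two_fun \<Rightarrow> ('j, 'k, 'm, 'c) cfunctor" where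
  "local_functor F = \<lparr>FObj = TMor F, FArr = TCell F\<rparr>"

definition post_composition :: "('o, 'm, 'c) two_cat \<Rightarrow> 'm \<Rightarrow> ('m, 'c, 'm, 'c) cfunctor" where
  "post_composition A g = \<lparr>FObj = Cmp A g, FArr = whisker_left A g\<rparr>"

definition lax_limit :: "('i, 'j, 'k) two_cat \<Rightarrow> ('o, 'm, 'c) two_cat
    \<Rightarrow> ('i, 'j, 'k, 'o, 'm, 'c) two_fun \<Rightarrow> 'o \<Rightarrow> ('i, 'j, 'k, 'o, 'm, 'c) lax_trans \<Rightarrow> bool" where
  "lax_limit I A F L l \<longleftrightarrow> lax_cone I A F L l \<and>
     (\<forall>X\<in>Obj A. iso_functor (hom_cat A X L) (hom_cat (Lax I A) (TObj (Delta I A) X) F)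
        (cfunctor_cmp (post_composition (Lax I A) l) (local_functor (Delta I A))))"

text \<open>A morphism of \<open>A\<close> may underlie several morphisms of the strict-slice, so morphisms and
  2-morphisms are triples recording their domain and codomain cones.\<close>

definition strict_slice :: "('i, 'j, 'k) two_cat \<Rightarrow> ('o, 'm, 'c) two_cat
    \<Rightarrow> ('i, 'j, 'k, 'o, 'm, 'c) two_fun
    \<Rightarrow> ('o \<times> ('i, 'j, 'k, 'o, 'm, 'c) lax_trans,
        ('o \<times> ('i, 'j, 'k, 'o, 'm, 'c) lax_trans) \<times> 'm \<times> ('o \<times> ('i, 'j, 'k, 'o, 'm, 'c) lax_trans),
        ('o \<times> ('i, 'j, 'k, 'o, 'm, 'c) lax_trans) \<times> 'c \<times> ('o \<times> ('i, 'j, 'k, 'o, 'm, 'c) lax_trans))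
       two_cat" where
  "strict_slice I A F =
    (let M = {((X, \<mu>), f, (Y, \<nu>)) | X \<mu> f Y \<nu>.
                lax_cone I A F X \<mu> \<and> lax_cone I A F Y \<nu> \<and>
                f \<in> Mor A \<and> Dom A f = X \<and> Cod A f = Y \<and>
                Cmp (Lax I A) \<nu> (TMor (Delta I A) f) = \<mu>}
     in \<lparr>Obj = {(X, \<mu>). lax_cone I A F X \<mu>},
         Mor = M,
         Cell = {((X, \<mu>), \<alpha>, (Y, \<nu>)) | X \<mu> \<alpha> Y \<nu>.
                   \<alpha> \<in> Cell A \<and> ((X, \<mu>), Src A \<alpha>, (Y, \<nu>)) \<in> M \<and> ((X, \<mu>), Tgt A \<alpha>, (Y, \<nu>)) \<in> M \<and>
                   whisker_left (Lax I A) \<nu> (TCell (Delta I A) \<alpha>) = VIde (Lax I A) \<mu>},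
         Dom = (\<lambda>(x, f, y). x),
         Cod = (\<lambda>(x, f, y). y),
         Ide = (\<lambda>x. (x, Ide A (fst x), x)),
         Cmp = (\<lambda>(y, g, z) (x, f, y'). (x, Cmp A g f, z)),
         Src = (\<lambda>(x, \<alpha>, y). (x, Src A \<alpha>, y)),
         Tgt = (\<lambda>(x, \<alpha>, y). (x, Tgt A \<alpha>, y)),
         VIde = (\<lambda>(x, f, y). (x, VIde A f, y)),
         VCmp = (\<lambda>(x, \<beta>, y) (x', \<alpha>, y'). (x, VCmp A \<beta> \<alpha>, y)),
         HCmp = (\<lambda>(y, \<beta>, z) (x, \<alpha>, y'). (x, HCmp A \<beta> \<alpha>, z))\<rparr>)"

end

(* A commutative monoid M gives a 2-category with one object, one morphism and M as its
   2-morphisms. Over the two constant objects of a discrete diagram there is exactly one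
   lax-cone, and a 2-morphism a that whiskers with it to the identity is 0, so this cone is
   2-terminal in the strict-slice. Its modifications are however arbitrary pairs in M \<times> M,
   whereas those induced by 2-morphisms lie on the diagonal. *)
theory Submission
  imports Defs
begin

text \<open>Identities are encoded by the object itself, so composable pairs have equal entries and
  either entry can serve as the composite.\<close>

definition discrete_two_cat :: "'a set \<Rightarrow> ('a, 'a, 'a) two_cat" where
  "discrete_two_cat S = \<lparr>Obj = S, Mor = S, Cell = S, Dom = id, Cod = id, Ide = id,
     Cmp = (\<lambda>_ f. f), Src = id, Tgt = id, VIde = id, VCmp = (\<lambda>_ f. f), HCmp = (\<lambda>_ f. f)\<rparr>"

text \<open>By the Eckmann-Hilton argument the two compositions of 2-morphisms must agree and
  commute, hence \<open>+\<close> in both places. The \<open>0\<close> of \<open>VIde\<close> is the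
  neutral element of the monoid; the other zeros merely label the object and the morphism.\<close>

definition double_delooping :: "(nat, nat, 'm::comm_monoid_add) two_cat" where
  "double_delooping = \<lparr>Obj = {0}, Mor = {0}, Cell = UNIV, Dom = (\<lambda>_. 0), Cod = (\<lambda>_. 0),
     Ide = (\<lambda>_. 0), Cmp = (\<lambda>_ _. 0), Src = (\<lambda>_. 0), Tgt = (\<lambda>_. 0), VIde = (\<lambda>_. 0),
     VCmp = (+), HCmp = (+)\<rparr>"

lemma two_category_discrete: "two_category (discrete_two_cat S)"
  unfolding two_category_def category_def
  by (simp add: discrete_two_cat_def underlying_cat_def vertical_cat_def horizontal_cat_def)

lemma two_category_double_delooping:
  "two_category (double_delooping :: (nat, nat, 'm::comm_monoid_add) two_cat)"
  unfolding two_category_def category_def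
  by (simp add: double_delooping_def underlying_cat_def vertical_cat_def horizontal_cat_def
      ac_simps)

context
  fixes S :: "'a set"
    and I :: "('a, 'a, 'a) two_cat"
    and A :: "(nat, nat, 'm::comm_monoid_add) two_cat"
    and F :: "('a, 'a, 'a, nat, nat, 'm) two_fun"
    and l :: "('a, 'a, 'a, nat, nat, 'm) lax_trans"
  defines "I \<equiv> discrete_two_cat S"
    and "A \<equiv> double_delooping"
    and "F \<equiv> const_fun I A 0"
    and "l \<equiv> const_trans I A 0"
begin

private lemma I_simps:
  "Obj I = S" "Mor I = S" "Cell I = S" "Dom I = id" "Cod I = id" "Ide I = id"
  "Cmp I = (\<lambda>_ f. f)" "Src I = id" "Tgt I = id" "VIde I = id" "VCmp I = (\<lambda>_ f. f)"
  "HCmp I = (\<lambda>_ f. f)"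
  by (simp_all add: I_def discrete_two_cat_def)

private lemma A_simps:
  "Obj A = {0}" "Mor A = {0}" "Cell A = UNIV" "Dom A = (\<lambda>_. 0)" "Cod A = (\<lambda>_. 0)"
  "Ide A = (\<lambda>_. 0)" "Cmp A = (\<lambda>_ _. 0)" "Src A = (\<lambda>_. 0)" "Tgt A = (\<lambda>_. 0)"
  "VIde A = (\<lambda>_. 0)" "VCmp A = (+)" "HCmp A = (+)"
  by (simp_all add: A_def double_delooping_def)

lemma two_functor_const_fun: "two_functor I A F"
  unfolding two_functor_def F_def const_fun_def by (auto simp: I_simps A_simps)

text \<open>Object components have only one possible value, and every morphism of a discrete diagram
  is an identity, so the unit law forces its 2-morphism to be neutral.\<close>

lemma lax_natural_iff_eq_const_trans:
  "lax_natural I A \<mu> \<and> LSrc \<mu> = F \<and> LTgt \<mu> = F \<longleftrightarrow> \<mu> = l"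
proof
  assume \<mu>: "lax_natural I A \<mu> \<and> LSrc \<mu> = F \<and> LTgt \<mu> = F"
  then interpret lax_natural I A \<mu> by simp
  have "LObj \<mu> = LObj l"
    by (rule PiE_ext[OF obj])
      (use PiE_mem[OF obj] in \<open>auto simp: l_def const_trans_def I_simps A_simps\<close>)
  moreover have "LMor \<mu> = LMor l"
    by (rule PiE_ext[OF mor])
      (use ide in \<open>auto simp: l_def const_trans_def I_simps A_simps\<close>)
  moreover have "LSrc l = F" "LTgt l = F"
    by (simp_all add: l_def const_trans_def F_def A_simps)
  ultimately show "\<mu> = l"
    using \<mu> by simp
next
  assume "\<mu> = l"
  then show "lax_natural I A \<mu> \<and> LSrc \<mu> = F \<and> LTgt \<mu> = F"
    using two_functor_const_fun unfolding lax_natural_def l_def const_trans_def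
    by (auto simp: F_def const_fun_def I_simps A_simps)
qed

lemma lax_cone_iff: "lax_cone I A F X \<mu> \<longleftrightarrow> X = 0 \<and> \<mu> = l"
  using lax_natural_iff_eq_const_trans[of \<mu>]
  by (auto simp: lax_cone_def Lax_def Delta_def F_def A_simps)

text \<open>Since \<open>l\<close> is also \<Delta> of the only morphism of \<open>A\<close>, this
  is the slice condition on that morphism.\<close>

lemma lax_cmp_const_trans: "lax_cmp I A l l = l"
  by (auto simp: l_def lax_cmp_def const_trans_def I_simps A_simps fun_eq_iff)

lemma strict_slice_Mor_iff: "m \<in> Mor (strict_slice I A F) \<longleftrightarrow> m = ((0, l), 0, (0, l))"
  using lax_cmp_const_trans
  by (auto simp: strict_slice_def Let_def lax_cone_iff Lax_def Delta_def A_simps simp flip: l_def)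

lemma strict_slice_Cell_iff:
  assumes "S \<noteq> {}"
  shows "c \<in> Cell (strict_slice I A F) \<longleftrightarrow> c = ((0, l), 0, (0, l))"
proof -
  \<comment> \<open>Each component of the whiskered modification is \<open>0 + \<alpha>\<close>, and
    \<open>S\<close> supplies at least one component; over an empty diagram every \<alpha> would
    qualify.\<close>
  have "HCmp (Lax I A) (VIde (Lax I A) l) (TCell (Delta I A) \<alpha>) = VIde (Lax I A) l \<longleftrightarrow> \<alpha> = 0"
    for \<alpha>
    using assms lax_cmp_const_trans
    by (auto simp: Lax_def Delta_def const_modif_def l_def I_simps A_simps fun_eq_iff)
  then show ?thesis
    using strict_slice_Mor_iff
    by (auto simp: strict_slice_def Let_def lax_cone_iff A_simps)
qed

lemma two_terminal_strict_slice:
  assumes "S \<noteq> {}"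
  shows "two_terminal (strict_slice I A F) (0, l)"
proof -
  let ?B = "strict_slice I A F" and ?x = "(0::nat, l)"
  have Obj: "Obj ?B = {?x}"
    by (auto simp: strict_slice_def Let_def lax_cone_iff)
  \<comment> \<open>The triple is used at two types: its \<open>0\<close> is the morphism of
    \<open>A\<close> in the first equation and the neutral 2-morphism in the second.\<close>
  have hom: "CObj (hom_cat ?B ?x ?x) = {(?x, 0, ?x)}" "CArr (hom_cat ?B ?x ?x) = {(?x, 0, ?x)}"
    using strict_slice_Mor_iff strict_slice_Cell_iff[OF assms]
    by (auto simp: hom_cat_def) (auto simp: strict_slice_def Let_def A_simps)
  have ops: "CDom (hom_cat ?B ?x ?x) (?x, 0, ?x) = (?x, 0, ?x)"
    "CCod (hom_cat ?B ?x ?x) (?x, 0, ?x) = (?x, 0, ?x)"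
    "CIde (hom_cat ?B ?x ?x) (?x, 0, ?x) = (?x, 0, ?x)"
    "CCmp (hom_cat ?B ?x ?x) (?x, 0, ?x) (?x, 0, ?x) = (?x, 0, ?x)"
    by (auto simp: hom_cat_def strict_slice_def Let_def A_simps)
  have "iso_functor (hom_cat ?B ?x ?x) terminal_cat \<lparr>FObj = \<lambda>_. (), FArr = \<lambda>_. ()\<rparr>"
    unfolding iso_functor_def cat_functor_def
    by (intro conjI exI[of _ "\<lparr>FObj = \<lambda>_. (?x, 0, ?x), FArr = \<lambda>_. (?x, 0, ?x)\<rparr>"])
      (simp_all add: hom ops terminal_cat_def)
  then show ?thesis
    by (auto simp: two_terminal_def Obj isomorphic_cats_def)
qed

lemma not_lax_limit:
  assumes "i \<in> S" "j \<in> S" "i \<noteq> j" and "(m::'m) \<noteq> 0"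
  shows "\<not> lax_limit I A F 0 l"
proof
  assume "lax_limit I A F 0 l"
  \<comment> \<open>\<open>F\<close> is itself \<Delta> of the object \<open>0\<close>, so the
    lax-cones from \<open>0\<close> are the endotransformations of \<open>F\<close>.\<close>
  then have iso: "iso_functor (hom_cat A 0 0) (hom_cat (Lax I A) F F)
      (cfunctor_cmp (post_composition (Lax I A) l) (local_functor (Delta I A)))"
    (is "iso_functor ?C ?D ?H")
    by (simp add: lax_limit_def Delta_def F_def A_simps)
  \<comment> \<open>An off-diagonal modification. Any family of 2-morphisms indexed by
    \<open>S\<close> is natural here, as a discrete diagram imposes naturality only at
    identities.\<close>
  define \<phi> where
    "\<phi> = \<lparr>MSrc = l, MTgt = l, MObj = (\<lambda>k\<in>S. if k = i then m else 0)\<rparr>"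
  have l: "lax_natural I A l" "LSrc l = F" "LTgt l = F"
    using lax_natural_iff_eq_const_trans by auto
  have "modification I A \<phi>"
    using l unfolding modification_def \<phi>_def
    by (auto simp: l_def const_trans_def const_fun_def I_simps A_simps)
  then have "\<phi> \<in> CArr ?D"
    using l by (simp add: hom_cat_def Lax_def \<phi>_def)
  \<comment> \<open>An isomorphism of categories is surjective on arrows, but every arrow in the
    image has equal components at \<open>i\<close> and \<open>j\<close>.\<close>
  then obtain \<alpha> where "FArr ?H \<alpha> = \<phi>"
    using iso by (auto simp: iso_functor_def)
  moreover have "MObj (FArr ?H \<alpha>) i = MObj (FArr ?H \<alpha>) j"
    using assms(1,2)
    by (simp add: cfunctor_cmp_def post_composition_def local_functor_def Lax_def Delta_def
        const_modif_def I_simps A_simps)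
  ultimately have "MObj \<phi> i = MObj \<phi> j"
    by simp
  with assms show False
    by (simp add: \<phi>_def)
qed

end

theorem mainTheorem11:
  shows "\<exists>(I :: (nat, nat, nat) two_cat) (A :: (nat, nat, nat) two_cat)
            (F :: (nat, nat, nat, nat, nat, nat) two_fun) (L :: nat)
            (l :: (nat, nat, nat, nat, nat, nat) lax_trans).
          two_category I \<and> two_category A \<and> two_functor I A F \<and>
          two_terminal (strict_slice I A F) (L, l) \<and> \<not> lax_limit I A F L l"
proof (intro exI conjI)
  \<comment> \<open>Two objects make the diagonal proper; the monoid is the additive naturals, with
    \<open>1\<close> as the nonzero 2-morphism.\<close>
  let ?S = "{0, 1 :: nat}"
  show "two_category (discrete_two_cat ?S)"
    by (rule two_category_discrete)
  show "two_category (double_delooping :: (nat, nat, nat) two_cat)"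
    by (rule two_category_double_delooping)
  show "two_functor (discrete_two_cat ?S) (double_delooping :: (nat, nat, nat) two_cat)
      (const_fun (discrete_two_cat ?S) double_delooping 0)"
    by (rule two_functor_const_fun)
  show "two_terminal (strict_slice (discrete_two_cat ?S) (double_delooping :: (nat, nat, nat) two_cat)
      (const_fun (discrete_two_cat ?S) double_delooping 0))
      (0, const_trans (discrete_two_cat ?S) double_delooping 0)"
    by (rule two_terminal_strict_slice) simp
  show "\<not> lax_limit (discrete_two_cat ?S) (double_delooping :: (nat, nat, nat) two_cat)
      (const_fun (discrete_two_cat ?S) double_delooping 0) 0
      (const_trans (discrete_two_cat ?S) double_delooping 0)"
    by (rule not_lax_limit[of 0 _ 1 1]) simp_all
qed

end
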